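(* Assume $X\subseteq\mathbb{R}^n$ and $\Theta\subseteq\mathbb{R}^d$ are convex and compact, and: (i) $h(x;\theta)=A(\theta)x+b(\theta)$ with $A(\theta)\in\mathbb{R}^{m\times n}$, $b(\theta)\in\mathbb{R}^m$, and there are constants $L_A,L_b$ with $\|A(\theta)-A(\theta^* )\|\le L_A\|\theta-\theta^*\|$ and $\|b(\theta)-b(\theta^* )\|\le L_b\|\theta-\theta^*\|$ for all $\theta\in\Theta$; (ii) $f(\cdot;\theta)$ is convex on $X$ for all $\theta\in\Theta$, and $|f(x;\theta)-f(x;\theta^* )|\le L_{f,\theta}\|\theta-\theta^*\|$ for all $\theta\in\Theta$, $x\in X$; (iii) there is a continuous function $\kappa:\mathcal{K}^*\to\mathbb{R}$ with positive values such that $X^*(\lambda;\theta)\subseteq X^*(\lambda;\theta^* )+\kappa(\lambda)\|\theta-\theta^*\|\,\mathcal{B}(\mathbf{0},1)$ for all $\lambda\in\mathcal{K}^*$, $\theta\in\Theta$. Let $\{\theta_k\}_{k\ge 0}\subseteq\Theta$ satisfy $\|\theta_k-\theta^*\|\le\tau^k\|\theta_0-\theta^*\|$ for all $k\ge0$, for some $\tau\in(0,1)$. Let $\{x_k\}_{k\ge0}$, $\{\lambda_k\}_{k\ge0}$ be generated by IPALM with constant penalty $\rho_k=\rho>0$ and tolerances $\alpha_k\ge 0$ with $\sum_{k=0}^\infty\sqrt{\alpha_k}<\infty$, let $\bar x_k\triangleq\frac1k\sum_{i=1}^kx_i$, and let $\lambda^*\in\operatorname{argmax}_\lambda g_0(\lambda;\theta^*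 )$ be arbitrary. Then for all $k\ge1$ $$d_{-\mathcal{K}}\big(h(\bar x_k;\theta^* )\big)\le\mathcal{V}(k)\triangleq\frac{C_1}{\sqrt k}+\frac{C_2}{k},$$ where $$C_1\triangleq\sqrt{\frac{2B_g}{\rho}+\Big(\frac{C_\lambda}{\rho}\Big)^2},\qquad C_2\triangleq\sqrt{\tfrac2\rho}\sum_{i=0}^\infty\sqrt{\alpha_i}+\frac{(L_{h,\theta}+\bar\kappa)\|\theta_0-\theta^*\|}{1-\tau},$$ $$B_g\triangleq\frac{1}{2\rho}\|\lambda_0-\lambda^*\|^2+C_\lambda\Big(\sqrt{\tfrac{2}{\rho}}\sum_{k=0}^\infty\sqrt{\alpha_k}+\frac{\bar\kappa\|\theta_0-\theta^*\|}{1-\tau}\Big),$$ $$C_\lambda\triangleq\sqrt{2\rho}\sum_{i=0}^\infty\sqrt{\alpha_i}+\rho\,\kappa_d(\lambda^* )\frac{\|\theta_0-\theta^*\|}{1-\tau}+\|\lambda_0-\lambda^*\|,\qquad \bar\kappa\triangleq\sup_{k\ge1}\kappa_d(\lambda_k).$$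
   Context: $\|\cdot\|$ is the Euclidean norm (spectral norm for matrices), $\mathcal{B}(\mathbf{0},1)$ the closed unit ball. $\mathcal{K}\subseteq\mathbb{R}^m$ is a closed convex cone, $\mathcal{K}^*$ its dual cone; for a closed convex set $C$, $\Pi_C$ is the Euclidean projection and $d_C(y)=\min_{s\in C}\|y-s\|$. $f:\mathbb{R}^n\times\Theta\to\mathbb{R}\cup\{+\infty\}$, $h:\mathbb{R}^n\times\Theta\to\mathbb{R}^m$; $\mathcal{C}(\theta):\ \min_x\{f(x;\theta):-h(x;\theta)\in\mathcal{K},\ x\in X\}$. $\theta^*\in\Theta$ is a fixed parameter (the unique minimizer over $\Theta$ of a learning objective). Standing assumption: $\mathcal{C}(\theta^* )$ has finite optimal value $f^*$ (attained on its solution set), its Lagrangian dual has a solution, and there is no duality gap. Lagrangian: $\mathcal{L}_0(x,\lambda;\theta)=f(x;\theta)+\lambda^\top h(x;\theta)$ if $\lambda\in\mathcal{K}^*$, and $-\infty$ otherwise. For $\rho>0$: $\mathcal{L}_\rho(x,\lambda;\theta)=f(x;\theta)+\frac{\rho}{2}d^2_{-\mathcal{K}}\big(h(x;\theta)+\frac{\lambda}{\rho}\big)-\frac{\|\lambda\|^2}{2\rho}$. For $\rho\ge 0$: $g_\rho(\lambda;\theta)=\inf_{x\in X}\mathcal{L}_\rho(x,\lambda;\theta)$. For $\rho>0$, $\nabla_\lambda\mathcal{L}_\rho(x,\lambda;\theta)=\Pi_{\mathcal{K}^*}\big(\frac{\lambda}{\rho}+h(x;\theta)\big)-\frac{\lambda}{\rho}$.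 $X^*(\lambda;\theta)=\operatorname{argmin}_{x\in X}\mathcal{L}_0(x,\lambda;\theta)$. Constants: $D_x=\max_{x\in X}\|x\|$, $L_{h,\theta}=L_AD_x+L_b$, $L_{h,x}=\max_{\theta\in\Theta}\|A(\theta)\|$ ($\|A(\cdot)\|$ is taken to be continuous on $\Theta$), $\kappa_d(\lambda)=L_{h,\theta}+\kappa(\lambda)L_{h,x}$. IPALM (inexact parametric augmented Lagrangian method): given $\lambda_0\in\mathcal{K}^*$, $x_0\in X$, penalties $\{\rho_k\}\subset(0,\infty)$, tolerances $\{\alpha_k\}$, and $\{\theta_k\}$, for each $k\ge0$: (1) choose any $x_{k+1}\in X$ with $\mathcal{L}_{\rho_k}(x_{k+1},\lambda_k;\theta_k)\le g_{\rho_k}(\lambda_k;\theta_k)+\alpha_k$; (2) set $\lambda_{k+1}=\lambda_k+\rho_k\nabla_\lambda\mathcal{L}_{\rho_k}(x_{k+1},\lambda_k;\theta_k)$, i.e. $\lambda_{k+1}=\Pi_{\mathcal{K}^*}(\lambda_k+\rho_kh(x_{k+1};\theta_k))$.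
   Formalization: The formal theorem additionally assumes that X*(λ;θ) is nonempty for all λ in K* and θ in Θ (automatic if f(·;θ) is lower semicontinuous on X); without this, (iii) can hold vacuously and the claimed bound fails. *)

theory Defs
  imports "HOL-Analysis.Analysis"
begin

definition dual_cone :: "'a::real_inner set \<Rightarrow> 'a set" where
  "dual_cone K = {y. \<forall>s\<in>K. 0 \<le> y \<bullet> s}"

(* The library norm on real^'n^'m is the Frobenius norm, hence the operator norm here. *)
definition spectral_norm :: "real^'n^'m \<Rightarrow> real" where
  "spectral_norm M = onorm (\<lambda>v. M *v v)"

(* Convexity for functions into ereal that avoid -\<infinity>.  At u = 0 and u = 1 the convention
   0 * \<infinity> = 0 makes the inequality trivial. *)
definition ereal_convex_on :: "'a::real_vector set \<Rightarrow> ('a \<Rightarrow> ereal) \<Rightarrow> bool" where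
  "ereal_convex_on S F \<longleftrightarrow> convex S \<and>
     (\<forall>x\<in>S. \<forall>y\<in>S. \<forall>u\<in>{0..1}.
        F ((1 - u) *\<^sub>R x + u *\<^sub>R y) \<le> ereal (1 - u) * F x + ereal u * F y)"

text \<open>
  The problem \<open>min {f x \<theta> | - h x \<theta> \<in> K, x \<in> X}\<close> with parameter \<open>\<theta>\<close>.
\<close>

definition feasible_set ::
  "('x \<Rightarrow> 't \<Rightarrow> 'm::real_inner) \<Rightarrow> 'x set \<Rightarrow> 'm set \<Rightarrow> 't \<Rightarrow> 'x set" where
  "feasible_set h X K \<theta> = {x\<in>X. - h x \<theta> \<in> K}"

definition optimal_value ::
  "('x \<Rightarrow> 't \<Rightarrow> ereal) \<Rightarrow> ('x \<Rightarrow> 't \<Rightarrow> 'm::real_inner) \<Rightarrow> 'x set \<Rightarrow> 'm set \<Rightarrow> 't \<Rightarrow> ereal" where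
  "optimal_value f h X K \<theta> = (INF x\<in>feasible_set h X K \<theta>. f x \<theta>)"

definition solution_set ::
  "('x \<Rightarrow> 't \<Rightarrow> ereal) \<Rightarrow> ('x \<Rightarrow> 't \<Rightarrow> 'm::real_inner) \<Rightarrow> 'x set \<Rightarrow> 'm set \<Rightarrow> 't \<Rightarrow> 'x set" where
  "solution_set f h X K \<theta> =
     {x. is_arg_min (\<lambda>x. f x \<theta>) (\<lambda>x. x \<in> feasible_set h X K \<theta>) x}"

(* \<rho> = 0 is the ordinary Lagrangian, \<rho> > 0 the augmented one. *)
definition lagrangian ::
  "('x \<Rightarrow> 't \<Rightarrow> ereal) \<Rightarrow> ('x \<Rightarrow> 't \<Rightarrow> 'm::real_inner) \<Rightarrow> 'm set \<Rightarrow> real \<Rightarrow> 'x \<Rightarrow> 'm \<Rightarrow> 't \<Rightarrow> ereal" where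
  "lagrangian f h K \<rho> x \<mu> \<theta> =
     (if \<rho> = 0 then (if \<mu> \<in> dual_cone K then f x \<theta> + ereal (\<mu> \<bullet> h x \<theta>) else -\<infinity>)
      else f x \<theta> + ereal (\<rho> / 2 * (infdist (h x \<theta> + \<mu> /\<^sub>R \<rho>) (uminus ` K))\<^sup>2
                           - (norm \<mu>)\<^sup>2 / (2 * \<rho>)))"

definition dual_function ::
  "('x \<Rightarrow> 't \<Rightarrow> ereal) \<Rightarrow> ('x \<Rightarrow> 't \<Rightarrow> 'm::real_inner) \<Rightarrow> 'x set \<Rightarrow> 'm set \<Rightarrow> real \<Rightarrow> 'm \<Rightarrow> 't \<Rightarrow> ereal" where
  "dual_function f h X K \<rho> \<mu> \<theta> = (INF x\<in>X. lagrangian f h K \<rho> x \<mu> \<theta>)"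

definition dual_solution_set ::
  "('x \<Rightarrow> 't \<Rightarrow> ereal) \<Rightarrow> ('x \<Rightarrow> 't \<Rightarrow> 'm::real_inner) \<Rightarrow> 'x set \<Rightarrow> 'm set \<Rightarrow> 't \<Rightarrow> 'm set" where
  "dual_solution_set f h X K \<theta> =
     {\<mu>. is_arg_max (\<lambda>\<mu>. dual_function f h X K 0 \<mu> \<theta>) (\<lambda>_. True) \<mu>}"

definition lagrangian_argmin ::
  "('x \<Rightarrow> 't \<Rightarrow> ereal) \<Rightarrow> ('x \<Rightarrow> 't \<Rightarrow> 'm::real_inner) \<Rightarrow> 'x set \<Rightarrow> 'm set \<Rightarrow> 'm \<Rightarrow> 't \<Rightarrow> 'x set" where
  "lagrangian_argmin f h X K \<mu> \<theta> =
     {x. is_arg_min (\<lambda>x. lagrangian f h K 0 x \<mu> \<theta>) (\<lambda>x. x \<in> X) x}"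

(* The closed form of the gradient of lagrangian f h K \<rho> x \<mu> \<theta> in \<mu>, for \<rho> > 0. *)
definition grad_lagrangian ::
  "('x \<Rightarrow> 't \<Rightarrow> 'm::euclidean_space) \<Rightarrow> 'm set \<Rightarrow> real \<Rightarrow> 'x \<Rightarrow> 'm \<Rightarrow> 't \<Rightarrow> 'm" where
  "grad_lagrangian h K \<rho> x \<mu> \<theta> =
     closest_point (dual_cone K) (\<mu> /\<^sub>R \<rho> + h x \<theta>) - \<mu> /\<^sub>R \<rho>"

definition ipalm ::
  "('x \<Rightarrow> 't \<Rightarrow> ereal) \<Rightarrow> ('x \<Rightarrow> 't \<Rightarrow> 'm::euclidean_space) \<Rightarrow> 'x set \<Rightarrow> 'm set \<Rightarrow>
   (nat \<Rightarrow> real) \<Rightarrow> (nat \<Rightarrow> real) \<Rightarrow> (nat \<Rightarrow> 't) \<Rightarrow> (nat \<Rightarrow> 'x) \<Rightarrow> (nat \<Rightarrow> 'm) \<Rightarrow> bool" where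
  "ipalm f h X K \<rho> \<alpha> \<theta> x \<mu> \<longleftrightarrow>
     \<mu> 0 \<in> dual_cone K \<and> x 0 \<in> X \<and> (\<forall>k. 0 < \<rho> k) \<and>
     (\<forall>k. x (Suc k) \<in> X \<and>
          lagrangian f h K (\<rho> k) (x (Suc k)) (\<mu> k) (\<theta> k)
            \<le> dual_function f h X K (\<rho> k) (\<mu> k) (\<theta> k) + ereal (\<alpha> k) \<and>
          \<mu> (Suc k) = \<mu> k + \<rho> k *\<^sub>R grad_lagrangian h K (\<rho> k) (x (Suc k)) (\<mu> k) (\<theta> k))"

end

theory Submission
  imports Defs
begin

text \<open>
  The multiplier update is a projection onto the dual cone, so by Moreau's decomposition
  \<open>h (x (Suc i)) (\<theta> i) + (lam i - lam (Suc i)) /\<^sub>R \<rho>\<close> lies in \<open>- K\<close>. Averaging over \<open>i < k\<close> leaves a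
  point of \<open>- K\<close>, and the multiplier differences telescope. As \<open>h\<close> is affine in \<open>x\<close>, the distance from
  \<open>h\<close> at the averaged iterate to \<open>- K\<close> is therefore at most \<open>norm (lam k - lam 0) / (\<rho> * k)\<close> plus the
  average of the errors made by using \<open>\<theta> i\<close> in place of \<open>\<theta>star\<close>. These errors sum to at most
  \<open>Lh\<^sub>\<theta> * norm (\<theta> 0 - \<theta>star) / (1 - \<tau>)\<close>. Thus everything rests on bounding the multipliers.

  The augmented Lagrangian step is an inexact proximal step of the dual function:
  \<open>inexact_prox_point\<close> provides the exact step and shows that \<open>lam (Suc k)\<close> misses it by at most
  \<open>sqrt (2 * \<rho> * \<alpha> k)\<close>. Proximal maps are nonexpansive and for \<open>\<theta>star\<close> they fix \<open>lamstar\<close>;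
  \<open>exact_dual_step_bounds\<close> shows that the perturbation of the parameter costs at most
  \<open>\<rho> * \<kappa>\<^sub>d lamstar * norm (\<theta> k - \<theta>star)\<close> per step. Summing both errors gives
  \<open>norm (lam k - lamstar) \<le> C\<^sub>lam\<close> for all \<open>k\<close>, and the same argument gives
  \<open>norm (lam 1 - lam 0) \<le> C\<^sub>lam\<close>.

  The violation is thus of order \<open>1 / k\<close>, and what is left is to compare constants. As \<open>C\<^sub>1\<close> is at
  least the Euclidean length of \<open>(C\<^sub>lam, norm (lam 0 - lamstar))\<close> divided by \<open>\<rho>\<close>, the bound
  \<open>norm (lam k - lam 0) \<le> C\<^sub>lam + norm (lam 0 - lamstar)\<close> suffices for \<open>k \<ge> 2\<close>, and the bound on
  \<open>norm (lam 1 - lam 0)\<close> for \<open>k = 1\<close> (\<open>violation_rate_arith\<close>).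
\<close>

section \<open>The spectral norm\<close>

lemma norm_matrix_vector_le_spectral_norm: "norm (M *v v) \<le> spectral_norm M * norm v"
  unfolding spectral_norm_def by (intro onorm matrix_vector_mul_bounded_linear)

lemma spectral_norm_nonneg: "0 \<le> spectral_norm M"
  unfolding spectral_norm_def by (intro onorm_pos_le matrix_vector_mul_bounded_linear)

section \<open>Projection onto the dual cone\<close>

lemma convex_cone_uminus_image:
  assumes "convex_cone K"
  shows "convex_cone (uminus ` K)"
  using assms by (intro convex_cone_linear_image) (auto intro: linear_uminus simp: module_hom_uminus)

lemma dual_cone_convex_closed:
  fixes K :: "'a::euclidean_space set"
  shows "convex (dual_cone K)" "closed (dual_cone K)" "0 \<in> dual_cone K"
proof -
  have eq: "dual_cone K = (\<Inter>s\<in>K. {y. s \<bullet> y \<ge> 0})"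
    by (auto simp: dual_cone_def inner_commute)
  show "convex (dual_cone K)"
    unfolding eq by (intro convex_INT convex_halfspace_ge)
  show "closed (dual_cone K)"
    unfolding eq by (intro closed_INT ballI closed_halfspace_ge)
  show "0 \<in> dual_cone K" by (simp add: dual_cone_def)
qed

lemma dual_cone_scaleR:
  assumes "y \<in> dual_cone K" "0 \<le> c"
  shows "c *\<^sub>R y \<in> dual_cone K"
  using assms by (auto simp: dual_cone_def)

text \<open>
  The residual is the projection \<open>r\<close> onto \<open>- K\<close>: scaling \<open>r\<close> inside the cone shows that \<open>y - r\<close> is
  orthogonal to \<open>r\<close>, hence lies in the dual cone, and the obtuse-angle characterization identifies
  it with \<open>P y\<close>. Starting from \<open>- K\<close> rather than from the dual cone avoids the bipolar theorem.
\<close>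

lemma moreau_decomposition:
  fixes K :: "'a::euclidean_space set"
  assumes "closed K" "convex_cone K"
  defines "P \<equiv> closest_point (dual_cone K)"
  shows "P y \<in> dual_cone K" "y - P y \<in> uminus ` K" "P y \<bullet> (y - P y) = 0"
    and "infdist y (uminus ` K) = norm (P y)"
proof -
  define N where "N = uminus ` K"
  note Ncone = convex_cone_uminus_image[OF assms(2), folded N_def]
  have Ncl: "closed N" unfolding N_def using assms(1) by (simp add: closed_negations)
  have Ncv: "convex N" and Nne: "N \<noteq> {}" using Ncone by (auto simp: convex_cone_def)
  define r where "r = closest_point N y"
  have rN: "r \<in> N" unfolding r_def using Ncl Nne by (rule closest_point_in_set)
  have dot: "(y - r) \<bullet> (s - r) \<le> 0" if "s \<in> N" for s
    unfolding r_def using closest_point_dot[OF Ncv Ncl that] .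
  have "2 *\<^sub>R r \<in> N" "0 \<in> N"
    using Ncone rN convex_cone_scaleR[of N 2 r] convex_cone_contains_0 by auto
  from dot[OF this(1)] dot[OF this(2)] have orth: "(y - r) \<bullet> r = 0"
    by (simp add: algebra_simps inner_simps scaleR_2)
  have qd: "y - r \<in> dual_cone K"
    unfolding dual_cone_def
  proof (intro CollectI ballI)
    fix s assume "s \<in> K"
    then have "- s \<in> N" by (simp add: N_def)
    from dot[OF this] orth show "0 \<le> (y - r) \<bullet> s" by (simp add: inner_simps)
  qed
  have "y - r = P y"
    unfolding P_def
  proof (rule closest_point_unique)
    show "\<forall>z\<in>dual_cone K. dist y (y - r) \<le> dist y z"
    proof
      fix z assume z: "z \<in> dual_cone K"
      obtain s where s: "s \<in> K" "r = - s" using rN by (auto simp: N_def)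
      then have "z \<bullet> r \<le> 0" using z by (auto simp: dual_cone_def)
      then have "(norm r)\<^sup>2 \<le> r \<bullet> (y - z)"
        using orth by (simp add: power2_norm_eq_inner inner_simps inner_commute)
      also have "\<dots> \<le> norm r * norm (y - z)" by (rule norm_cauchy_schwarz)
      finally have "norm r \<le> norm (y - z)"
        by (cases "norm r = 0") (auto simp: power2_eq_square)
      then show "dist y (y - r) \<le> dist y z" by (simp add: dist_norm)
    qed
  qed (use dual_cone_convex_closed qd in auto)
  then have Py: "P y = y - r" and r: "y - P y = r" by (simp_all add: algebra_simps)
  show "P y \<in> dual_cone K" "y - P y \<in> uminus ` K" "P y \<bullet> (y - P y) = 0"
    using Py qd rN orth by (auto simp: N_def)
  have "infdist y N = dist y r"
    unfolding r_def using setdist_closest_point[OF Ncl Nne, of y]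
    by (simp add: infdist_eq_setdist)
  then show "infdist y (uminus ` K) = norm (P y)"
    by (simp add: Py N_def dist_norm)
qed

text \<open>
  Half the squared distance to \<open>- K\<close> is the maximum of \<open>q \<bullet> y - (norm q)\<^sup>2 / 2\<close> over the dual cone.
  The objective is strongly concave, so the gap to the maximum controls the distance to the
  maximizer \<open>P y\<close>; this is what turns suboptimality in the primal into distance between multipliers.
\<close>

lemma conjugate_le_half_infdist_square:
  fixes K :: "'a::euclidean_space set"
  assumes "closed K" "convex_cone K" "q \<in> dual_cone K"
  shows "q \<bullet> y - (norm q)\<^sup>2 / 2 + (norm (closest_point (dual_cone K) y - q))\<^sup>2 / 2
           \<le> (infdist y (uminus ` K))\<^sup>2 / 2"
proof -
  define p where "p = closest_point (dual_cone K) y"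
  note M = moreau_decomposition[OF assms(1,2), of y, folded p_def]
  obtain s where "s \<in> K" "y - p = - s" using M(2) by auto
  then have "q \<bullet> (y - p) \<le> 0" using assms(3) by (auto simp: dual_cone_def)
  then have "q \<bullet> y \<le> q \<bullet> p" by (simp add: inner_simps)
  then show ?thesis
    unfolding M(4) p_def[symmetric]
    by (simp add: power2_norm_eq_inner inner_simps inner_commute field_simps)
qed

text \<open>
  Smoothness of the penalty, with gradient \<open>P\<close>: the point of \<open>- K\<close> nearest to \<open>y\<close> is still a
  candidate for \<open>y + d\<close>.
\<close>

lemma half_infdist_square_upper:
  fixes K :: "'a::euclidean_space set"
  assumes "closed K" "convex_cone K"
  shows "(infdist (y + d) (uminus ` K))\<^sup>2 / 2
     \<le> (infdist y (uminus ` K))\<^sup>2 / 2 + closest_point (dual_cone K) y \<bullet> d + (norm d)\<^sup>2 / 2"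
proof -
  define p where "p = closest_point (dual_cone K) y"
  note M = moreau_decomposition[OF assms, of y, folded p_def]
  have "infdist (y + d) (uminus ` K) \<le> norm (p + d)"
    using infdist_le[OF M(2), of "y + d"] by (simp add: dist_norm algebra_simps)
  then have "(infdist (y + d) (uminus ` K))\<^sup>2 \<le> (norm (p + d))\<^sup>2"
    by (intro power_mono infdist_nonneg)
  also have "\<dots> = (norm p)\<^sup>2 + 2 * (p \<bullet> d) + (norm d)\<^sup>2"
    by (simp add: power2_norm_eq_inner inner_simps inner_commute)
  finally show ?thesis unfolding M(4) p_def[symmetric] by simp
qed

section \<open>Inexact proximal steps of the dual function\<close>

text \<open>
  First-order optimality: divide by \<open>t\<close> and let \<open>t\<close> tend to \<open>0\<close>.
\<close>

lemma nonneg_of_small_quadratic: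
  fixes u c :: real
  assumes "\<And>t. 0 < t \<Longrightarrow> t \<le> 1 \<Longrightarrow> 0 \<le> t * u + t\<^sup>2 * c"
  shows "0 \<le> u"
proof -
  have "((\<lambda>t. u + t * c) \<longlongrightarrow> u + 0 * c) (at_right 0)"
    by (intro tendsto_intros)
  moreover have "\<forall>\<^sub>F t in at_right 0. 0 \<le> u + t * c"
    unfolding eventually_at_right_field
  proof (intro exI[of _ "1::real"] conjI allI impI)
    fix t :: real assume t: "0 < t" "t < 1"
    then have "0 \<le> t * (u + t * c)"
      using assms[of t] by (simp add: algebra_simps power2_eq_square)
    then show "0 \<le> u + t * c" using t by (simp add: zero_le_mult_iff)
  qed simp
  ultimately show ?thesis
    by (simp add: tendsto_lowerbound)
qed

text \<open>
  Here \<open>\<phi>\<close> is the augmented Lagrangian at the multiplier \<open>\<rho> *\<^sub>R y\<close>, up to a constant, and \<open>\<rho> *\<^sub>R q\<close> is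
  the exact proximal step of the dual function from that multiplier. The first property of \<open>q\<close> says
  that \<open>q - y\<close> is a supergradient of the dual function at \<open>\<rho> *\<^sub>R q\<close>, relative to the dual cone; the
  constants \<open>c\<close> range over the lower bounds whose supremum is the dual value at \<open>\<mu>\<close>. The second
  property bounds the error of an inexact step by the tolerance.

  As \<open>F\<close> is only convex, it may jump at the boundary of \<open>X\<close>, so \<open>\<phi>\<close> need not attain its infimum.
  A minimizing sequence that converges to some \<open>l\<close> is used instead: along it \<open>H\<close> tends to \<open>H l\<close>, so
  the penalty converges and therefore \<open>F\<close> too, whose limit \<open>c\<close> stands in for the value at \<open>l\<close>. Comparing
  the sequence with its convex combinations with a fixed \<open>w\<close> gives the first-order condition that
  \<open>(c, H l)\<close> minimizes the Lagrangian at the multiplier \<open>\<rho> *\<^sub>R q\<close> with \<open>q = P (H l + y)\<close>.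
\<close>

lemma inexact_prox_point:
  fixes K :: "'m::euclidean_space set" and X :: "'n::euclidean_space set" and y :: 'm
  assumes K: "closed K" "convex_cone K" and X: "compact X" "X \<noteq> {}"
    and F: "convex_on X F" and F_lower: "\<And>z. z \<in> X \<Longrightarrow> m \<le> F z"
    and H_cont: "continuous_on X H"
    and H_affine: "\<And>z w t. H ((1 - t) *\<^sub>R z + t *\<^sub>R w) = (1 - t) *\<^sub>R H z + t *\<^sub>R H w"
    and \<rho>: "0 < \<rho>"
  defines "P \<equiv> closest_point (dual_cone K)"
    and "\<phi> \<equiv> \<lambda>z. F z + \<rho> / 2 * (infdist (H z + y) (uminus ` K))\<^sup>2"
  obtains q where "q \<in> dual_cone K"
    and "\<And>\<mu> c z. \<mu> \<in> dual_cone K \<Longrightarrow> (\<And>w. w \<in> X \<Longrightarrow> c \<le> F w + \<mu> \<bullet> H w) \<Longrightarrow> z \<in> X \<Longrightarrow>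
           c \<le> F z + (\<rho> *\<^sub>R q) \<bullet> H z + (\<mu> - \<rho> *\<^sub>R q) \<bullet> (q - y)"
    and "\<And>z a. z \<in> X \<Longrightarrow> (\<And>w. w \<in> X \<Longrightarrow> \<phi> z \<le> \<phi> w + a) \<Longrightarrow>
           \<rho> / 2 * (norm (P (H z + y) - q))\<^sup>2 \<le> a"
proof -
  define M where "M u = \<rho> / 2 * (infdist (u + y) (uminus ` K))\<^sup>2" for u
  have \<phi>: "\<phi> z = F z + M (H z)" for z by (simp add: \<phi>_def M_def)
  define v where "v = (INF z\<in>X. \<phi> z)"
  have Xcv: "convex X" using F by (simp add: convex_on_def)
  have bdd: "bdd_below (\<phi> ` X)"
    using F_lower \<rho> by (intro bdd_belowI2[of _ m]) (auto simp: \<phi>_def intro: add_increasing2)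
  have v_le: "v \<le> \<phi> z" if "z \<in> X" for z
    unfolding v_def using bdd that by (rule cINF_lower)
  have "\<exists>z\<in>X. \<phi> z < v + 1 / real (Suc n)" for n
    using cINF_less_iff[OF X(2) bdd, of "v + 1 / real (Suc n)"] by (simp add: v_def)
  then obtain Z where Z: "\<And>n. Z n \<in> X" "\<And>n. \<phi> (Z n) < v + 1 / real (Suc n)"
    by metis
  obtain l s where l: "l \<in> X" and s: "strict_mono s" and lim: "(Z \<circ> s) \<longlonglongrightarrow> l"
    using X(1) Z(1) unfolding compact_def by metis
  define z where "z n = Z (s n)" for n
  have zX: "z n \<in> X" for n using Z by (simp add: z_def)
  have zl: "z \<longlonglongrightarrow> l" using lim by (simp add: z_def[abs_def] comp_def)
  have Hl: "(\<lambda>n. H (z n)) \<longlonglongrightarrow> H l"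
    using continuous_on_tendsto_compose[OF H_cont zl l] zX by simp
  have \<phi>l: "(\<lambda>n. \<phi> (z n)) \<longlonglongrightarrow> v"
  proof (rule tendsto_sandwich)
    show "\<forall>\<^sub>F n in sequentially. v \<le> \<phi> (z n)" using v_le zX by simp
    have "\<phi> (z n) \<le> v + 1 / real (Suc n)" for n
    proof -
      have "n \<le> s n" using s by (rule seq_suble)
      then have "1 / real (Suc (s n)) \<le> 1 / real (Suc n)" by (simp add: field_simps)
      then show ?thesis using Z(2)[of "s n"] by (simp add: z_def)
    qed
    then show "\<forall>\<^sub>F n in sequentially. \<phi> (z n) \<le> v + 1 / real (Suc n)" by simp
    show "(\<lambda>n. v + 1 / real (Suc n)) \<longlonglongrightarrow> v"
      using tendsto_add[OF tendsto_const LIMSEQ_inverse_real_of_nat, of v]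
      by (simp add: inverse_eq_divide)
  qed simp
  have M_cont: "(\<lambda>n. M (U n)) \<longlonglongrightarrow> M u" if "U \<longlonglongrightarrow> u" for U u
    unfolding M_def using that by (intro tendsto_intros)
  (* The limit of F along z; in general F l differs from it. *)
  define c where "c = v - M (H l)"
  have Fl: "(\<lambda>n. F (z n)) \<longlonglongrightarrow> c"
    using tendsto_diff[OF \<phi>l M_cont[OF Hl]] by (simp add: \<phi> c_def)
  define q where "q = P (H l + y)"
  have qK: "q \<in> dual_cone K"
    unfolding q_def P_def by (rule moreau_decomposition[OF K])
  have subgrad: "c + (\<rho> *\<^sub>R q) \<bullet> H l \<le> F w + (\<rho> *\<^sub>R q) \<bullet> H w" if w: "w \<in> X" for w
  proof -
    define d where "d = H w - H l"
    have "0 \<le> t * (F w - c + \<rho> * (q \<bullet> d)) + t\<^sup>2 * (\<rho> / 2 * (norm d)\<^sup>2)" if t: "0 < t" "t \<le> 1" for t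
    proof -
      have "v \<le> (1 - t) * F (z n) + t * F w + M ((1 - t) *\<^sub>R H (z n) + t *\<^sub>R H w)" for n
      proof -
        have "(1 - t) *\<^sub>R z n + t *\<^sub>R w \<in> X"
          using Xcv zX w t by (simp add: convex_alt)
        from v_le[OF this] convex_onD[OF F _ _ zX[of n] w, of t] t show ?thesis
          by (simp add: \<phi> H_affine)
      qed
      moreover have "(\<lambda>n. (1 - t) * F (z n) + t * F w + M ((1 - t) *\<^sub>R H (z n) + t *\<^sub>R H w))
         \<longlonglongrightarrow> (1 - t) * c + t * F w + M ((1 - t) *\<^sub>R H l + t *\<^sub>R H w)"
        by (intro tendsto_intros Fl M_cont Hl)
      ultimately have "v \<le> (1 - t) * c + t * F w + M ((1 - t) *\<^sub>R H l + t *\<^sub>R H w)"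
        by (intro LIMSEQ_le_const) auto
      also have "(1 - t) *\<^sub>R H l + t *\<^sub>R H w = H l + t *\<^sub>R d"
        by (simp add: d_def algebra_simps)
      also have "M (H l + t *\<^sub>R d) \<le> M (H l) + \<rho> * (t * (q \<bullet> d)) + \<rho> * (t\<^sup>2 * (norm d)\<^sup>2 / 2)"
        using mult_left_mono[OF half_infdist_square_upper[OF K, of "H l + y" "t *\<^sub>R d"], of \<rho>] \<rho> t
        by (simp add: M_def q_def P_def algebra_simps power_mult_distrib)
      finally show ?thesis by (simp add: c_def algebra_simps)
    qed
    then have "0 \<le> F w - c + \<rho> * (q \<bullet> d)" by (rule nonneg_of_small_quadratic)
    then show ?thesis by (simp add: d_def inner_simps algebra_simps)
  qed
  show thesis
  proof (rule that[OF qK])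
    fix \<mu> c' w assume \<mu>: "\<mu> \<in> dual_cone K" and c': "\<And>w. w \<in> X \<Longrightarrow> c' \<le> F w + \<mu> \<bullet> H w"
      and w: "w \<in> X"
    have "(\<lambda>n. F (z n) + \<mu> \<bullet> H (z n)) \<longlonglongrightarrow> c + \<mu> \<bullet> H l"
      by (intro tendsto_intros Fl Hl)
    then have le: "c' \<le> c + \<mu> \<bullet> H l"
      using c' zX by (intro LIMSEQ_le_const) auto
    have "(\<mu> - \<rho> *\<^sub>R q) \<bullet> (H l + y - q) \<le> 0"
    proof -
      have "(inverse \<rho>) *\<^sub>R \<mu> \<in> dual_cone K"
        using \<mu> \<rho> by (intro dual_cone_scaleR) auto
      from closest_point_dot[OF dual_cone_convex_closed(1,2) this, of "H l + y"]
      have "(inverse \<rho> *\<^sub>R \<mu> - q) \<bullet> (H l + y - q) \<le> 0"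
        by (simp add: q_def P_def inner_commute)
      then have "\<rho> * ((inverse \<rho> *\<^sub>R \<mu> - q) \<bullet> (H l + y - q)) \<le> 0"
        using \<rho> by (simp add: mult_le_0_iff)
      moreover have "\<mu> - \<rho> *\<^sub>R q = \<rho> *\<^sub>R (inverse \<rho> *\<^sub>R \<mu> - q)"
        using \<rho> by (simp add: algebra_simps)
      ultimately show ?thesis by simp
    qed
    then show "c' \<le> F w + (\<rho> *\<^sub>R q) \<bullet> H w + (\<mu> - \<rho> *\<^sub>R q) \<bullet> (q - y)"
      using le subgrad[OF w] by (simp add: inner_simps algebra_simps)
  next
    fix w a assume w: "w \<in> X" and a: "\<And>w'. w' \<in> X \<Longrightarrow> \<phi> w \<le> \<phi> w' + a"
    have "\<phi> w \<le> v + a"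
      using LIMSEQ_le_const[OF tendsto_add[OF \<phi>l tendsto_const[of a]]] a zX by auto
    moreover have "\<rho> * (q \<bullet> (H w + y)) - \<rho> * (norm q)\<^sup>2 / 2 + \<rho> / 2 * (norm (P (H w + y) - q))\<^sup>2 \<le> M (H w)"
      using mult_left_mono[OF conjugate_le_half_infdist_square[OF K qK, of "H w + y"], of \<rho>] \<rho>
      by (simp add: M_def P_def algebra_simps)
    moreover have "M (H l) = \<rho> * (q \<bullet> (H l + y)) - \<rho> * (norm q)\<^sup>2 / 2"
    proof -
      have "q \<bullet> (H l + y) = (norm q)\<^sup>2"
        using moreau_decomposition(3)[OF K, of "H l + y"]
        by (simp add: q_def P_def inner_diff_right power2_norm_eq_inner)
      then show ?thesis
        using moreau_decomposition(4)[OF K, of "H l + y"] by (simp add: M_def q_def P_def)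
    qed
    ultimately show "\<rho> / 2 * (norm (P (H w + y) - q))\<^sup>2 \<le> a"
      using subgrad[OF w] by (simp add: \<phi> c_def inner_simps algebra_simps)
  qed
qed

section \<open>Perturbed proximal steps\<close>

text \<open>
  This is the estimate behind firm nonexpansiveness with a defect \<open>\<eta>\<close>. With \<open>w\<close> the old error and
  \<open>a\<close> the new one, the hypothesis says that the angle between the step \<open>a - w\<close> and \<open>a\<close> is obtuse
  up to \<open>\<eta>\<close>; without the defect, \<open>w\<close> would be the longest side of the triangle.
\<close>

lemma firm_step_bounds:
  fixes a w :: "'a::real_inner"
  assumes "(a - w) \<bullet> a \<le> \<eta> * norm a" "0 \<le> \<eta>"
  shows "norm a \<le> norm w + \<eta>" "norm (a - w) \<le> norm w + \<eta>"
proof -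
  have aw: "a \<bullet> w \<le> norm a * norm w" by (rule norm_cauchy_schwarz)
  have "norm a * norm a \<le> norm a * (norm w + \<eta>)"
    using assms(1) aw by (simp add: inner_simps algebra_simps power2_norm_eq_inner[symmetric]
        power2_eq_square inner_commute)
  then show "norm a \<le> norm w + \<eta>"
    using assms(2) by (cases "norm a = 0") auto
  have "(norm (a - w))\<^sup>2 = 2 * ((a - w) \<bullet> a) - (norm a)\<^sup>2 + (norm w)\<^sup>2"
    by (simp add: power2_norm_eq_inner inner_simps inner_commute)
  also have "\<dots> \<le> \<eta>\<^sup>2 + (norm w)\<^sup>2 - (norm a - \<eta>)\<^sup>2"
    using assms(1) by (simp add: power2_eq_square algebra_simps)
  also have "\<dots> \<le> \<eta>\<^sup>2 + (norm w)\<^sup>2" by simp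
  also have "\<dots> \<le> (norm w + \<eta>)\<^sup>2"
    using assms(2) by (simp add: power2_sum)
  finally show "norm (a - w) \<le> norm w + \<eta>"
    by (rule power2_le_imp_le) (use assms(2) in simp)
qed

text \<open>
  A proximal step from \<open>\<nu>\<close> for a perturbed dual function stays almost as close to the optimal
  multiplier \<open>\<mu>star\<close> of the unperturbed one. The supergradients \<open>H z\<close> of the perturbed function at \<open>\<mu>\<close>
  are within \<open>e \<mu>\<close> of supergradients \<open>s\<close> of the unperturbed one, and \<open>(\<mu> - \<mu>star) \<bullet> s \<le> 0\<close> expresses
  the optimality of \<open>\<mu>star\<close>.

  Comparing supergradients at \<open>p\<close> itself would produce \<open>e p\<close>, whereas at \<open>\<mu>star\<close> the inclusion of the
  supergradients is one-sided and says nothing about \<open>s\<close> in the direction \<open>p - \<mu>star\<close>. At a point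
  \<open>m n\<close> strictly between them, monotonicity can be used towards both ends, so the bound holds with
  \<open>e (m n)\<close>; as \<open>m n\<close> tends to \<open>\<mu>star\<close>, continuity gives \<open>e \<mu>star\<close>.
\<close>

lemma exact_dual_step_bounds:
  fixes H :: "'n \<Rightarrow> 'm::real_inner"
  assumes D: "convex D" "\<mu>star \<in> D" "p \<in> D"
    and \<rho>: "0 < \<rho>"
    and prox: "\<And>\<mu> c z. \<mu> \<in> D \<Longrightarrow> (\<And>w. w \<in> X \<Longrightarrow> c \<le> F w + \<mu> \<bullet> H w) \<Longrightarrow> z \<in> X \<Longrightarrow>
           c \<le> F z + p \<bullet> H z + (\<mu> - p) \<bullet> ((p - \<nu>) /\<^sub>R \<rho>)"
    and pert: "\<And>\<mu>. \<mu> \<in> D \<Longrightarrow> \<exists>z\<in>X. \<exists>s. (\<forall>w\<in>X. F z + \<mu> \<bullet> H z \<le> F w + \<mu> \<bullet> H w)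
           \<and> norm (H z - s) \<le> e \<mu> \<and> (\<mu> - \<mu>star) \<bullet> s \<le> 0"
    and e: "continuous_on D e" "0 \<le> e \<mu>star"
  shows "norm (p - \<mu>star) \<le> norm (\<nu> - \<mu>star) + \<rho> * e \<mu>star"
    and "norm (p - \<nu>) \<le> norm (\<nu> - \<mu>star) + \<rho> * e \<mu>star"
proof -
  define d where "d = p - \<mu>star"
  (* Suc (Suc n) keeps the weight of d below 1, so that m n is never p itself unless d = 0. *)
  define m where "m n = \<mu>star + (1 / real (Suc (Suc n))) *\<^sub>R d" for n
  have mD: "m n \<in> D" for n
  proof -
    have "m n = (1 - 1 / real (Suc (Suc n))) *\<^sub>R \<mu>star + (1 / real (Suc (Suc n))) *\<^sub>R p"
      by (simp add: m_def d_def algebra_simps)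
    also have "\<dots> \<in> D"
      by (rule convexD_alt[OF D(1-3)]) auto
    finally show ?thesis .
  qed
  have bound: "(p - \<nu>) \<bullet> d \<le> \<rho> * e (m n) * norm d" for n
  proof -
    define t where "t = 1 / real (Suc (Suc n))"
    have t: "0 < t" "t < 1" by (auto simp: t_def)
    obtain z s where z: "z \<in> X" "\<And>w. w \<in> X \<Longrightarrow> F z + m n \<bullet> H z \<le> F w + m n \<bullet> H w"
      and s: "norm (H z - s) \<le> e (m n)" "(m n - \<mu>star) \<bullet> s \<le> 0"
      using pert[OF mD[of n]] by blast
    have pm: "p - m n = (1 - t) *\<^sub>R d"
      by (simp add: m_def d_def t_def algebra_simps)
    have mp: "m n - p = - ((1 - t) *\<^sub>R d)" unfolding pm[symmetric] by simp
    from prox[OF mD z(2) z(1)]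
    have "0 \<le> (p - m n) \<bullet> H z + (m n - p) \<bullet> ((p - \<nu>) /\<^sub>R \<rho>)"
      by (simp add: inner_simps algebra_simps)
    also have "\<dots> = (1 - t) * (d \<bullet> H z - d \<bullet> (p - \<nu>) / \<rho>)"
      unfolding pm mp by (simp add: right_diff_distrib divide_inverse_commute)
    finally have "d \<bullet> (p - \<nu>) / \<rho> \<le> d \<bullet> H z"
      using t zero_le_mult_iff[of "1 - t"] by auto
    also have "\<dots> = d \<bullet> (H z - s) + d \<bullet> s" by (simp add: inner_simps)
    also have "d \<bullet> s \<le> 0"
      using s(2) unfolding m_def by (simp add: mult_le_0_iff divide_le_0_iff)
    also have "d \<bullet> (H z - s) \<le> norm d * e (m n)"
      using norm_cauchy_schwarz[of d "H z - s"] mult_left_mono[OF s(1), of "norm d"] by simp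
    finally have "d \<bullet> (p - \<nu>) / \<rho> \<le> norm d * e (m n)" by simp
    then have "d \<bullet> (p - \<nu>) \<le> norm d * e (m n) * \<rho>" using \<rho> by (simp add: pos_divide_le_eq)
    then show ?thesis by (simp add: inner_commute mult_ac)
  qed
  have "(\<lambda>n. 1 / real (Suc (Suc n))) \<longlonglongrightarrow> 0"
    using LIMSEQ_Suc[OF LIMSEQ_inverse_real_of_nat] by (simp add: inverse_eq_divide)
  then have "(\<lambda>n. m n) \<longlonglongrightarrow> \<mu>star + 0 *\<^sub>R d" unfolding m_def by (intro tendsto_intros)
  then have "(\<lambda>n. m n) \<longlonglongrightarrow> \<mu>star" by simp
  from continuous_on_tendsto_compose[OF e(1) this D(2)] mD
  have "(\<lambda>n. e (m n)) \<longlonglongrightarrow> e \<mu>star" by simp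
  then have "(\<lambda>n. \<rho> * e (m n) * norm d) \<longlonglongrightarrow> \<rho> * e \<mu>star * norm d"
    by (intro tendsto_intros)
  then have "(p - \<nu>) \<bullet> d \<le> \<rho> * e \<mu>star * norm d"
    by (rule LIMSEQ_le_const) (simp add: bound)
  then have main: "((p - \<mu>star) - (\<nu> - \<mu>star)) \<bullet> (p - \<mu>star) \<le> \<rho> * e \<mu>star * norm (p - \<mu>star)"
    by (simp add: d_def)
  have "0 \<le> \<rho> * e \<mu>star" using \<rho> e by simp
  from firm_step_bounds[OF main this]
  show "norm (p - \<mu>star) \<le> norm (\<nu> - \<mu>star) + \<rho> * e \<mu>star"
    and "norm (p - \<nu>) \<le> norm (\<nu> - \<mu>star) + \<rho> * e \<mu>star" by simp_all
qed

section \<open>Violation of the averaged iterates\<close>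

text \<open>
  The violation estimate decays like \<open>1 / k\<close>, and this absorbs its constant into the \<open>1 / sqrt k\<close> term.
  For \<open>k \<ge> 2\<close> the bound \<open>a + e \<le> sqrt (2 * (a\<^sup>2 + e\<^sup>2))\<close> suffices, as the factor \<open>2\<close> is paid for by \<open>k\<close>.
  At \<open>k = 1\<close> it does not, which is why a sharper bound on \<open>r\<close> is then assumed.
\<close>

lemma violation_rate_arith:
  fixes a e c r :: real
  assumes "0 \<le> a" "0 \<le> e" "0 \<le> c" "1 \<le> k" "r \<le> a + e" "k = 1 \<Longrightarrow> r \<le> a"
  shows "r / real k \<le> sqrt (a\<^sup>2 + e\<^sup>2 + 2 * a * c) / sqrt (real k)"
proof -
  have le: "r \<le> sqrt (real k) * sqrt (a\<^sup>2 + e\<^sup>2 + 2 * a * c)"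
  proof (cases "k = 1")
    case True
    have "0 \<le> e\<^sup>2" "0 \<le> 2 * a * c" using assms(1,3) by simp_all
    then have "a\<^sup>2 \<le> a\<^sup>2 + e\<^sup>2 + 2 * a * c" by linarith
    then have "a \<le> sqrt (a\<^sup>2 + e\<^sup>2 + 2 * a * c)" by (rule real_le_rsqrt)
    moreover have "sqrt (real k) = 1" unfolding True by simp
    ultimately show ?thesis using assms(6)[OF True] by simp
  next
    case False
    then have "2 \<le> real k" using assms(4) by simp
    have "(a + e)\<^sup>2 \<le> 2 * (a\<^sup>2 + e\<^sup>2)"
      using sum_squares_bound[of a e] by (simp add: power2_eq_square algebra_simps)
    also have "\<dots> \<le> real k * (a\<^sup>2 + e\<^sup>2 + 2 * a * c)"
      using assms \<open>2 \<le> real k\<close> by (intro mult_mono) auto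
    finally have "a + e \<le> sqrt (real k * (a\<^sup>2 + e\<^sup>2 + 2 * a * c))"
      by (rule real_le_rsqrt)
    then show ?thesis
      using assms(5) unfolding real_sqrt_mult by (rule order_trans[rotated])
  qed
  have "r / real k \<le> (sqrt (real k) * sqrt (a\<^sup>2 + e\<^sup>2 + 2 * a * c)) / real k"
    using le by (intro divide_right_mono) auto
  also have "\<dots> = sqrt (a\<^sup>2 + e\<^sup>2 + 2 * a * c) / sqrt (real k)"
    using assms(4) by (simp add: field_simps)
  finally show ?thesis .
qed

theorem theorem5:
  fixes X :: "(real^'n) set" and \<Theta> :: "(real^'d) set" and K :: "(real^'m) set"
    and f :: "real^'n \<Rightarrow> real^'d \<Rightarrow> ereal" and h :: "real^'n \<Rightarrow> real^'d \<Rightarrow> real^'m"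
    and A :: "real^'d \<Rightarrow> real^'n^'m" and b :: "real^'d \<Rightarrow> real^'m"
    and \<theta>star :: "real^'d" and \<theta> :: "nat \<Rightarrow> real^'d"
    and x :: "nat \<Rightarrow> real^'n" and lam :: "nat \<Rightarrow> real^'m" and lamstar :: "real^'m"
    and \<kappa> \<kappa>\<^sub>d :: "real^'m \<Rightarrow> real" and \<alpha> :: "nat \<Rightarrow> real"
    and \<rho> \<tau> L\<^sub>A L\<^sub>b L\<^sub>f D\<^sub>x Lh\<^sub>\<theta> Lh\<^sub>x \<kappa>bar C\<^sub>lam B\<^sub>g C\<^sub>1 C\<^sub>2 :: real
  assumes K: "closed K" "convex_cone K"
    and X: "convex X" "compact X"
    and \<Theta>: "convex \<Theta>" "compact \<Theta>"
    and \<theta>star: "\<theta>star \<in> \<Theta>"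
    and f_proper: "\<And>z t. t \<in> \<Theta> \<Longrightarrow> f z t \<noteq> -\<infinity>"
    \<comment> \<open>standing assumption on the problem at \<open>\<theta>star\<close>\<close>
    and finite_value: "\<bar>optimal_value f h X K \<theta>star\<bar> \<noteq> \<infinity>"
    and primal_solution: "solution_set f h X K \<theta>star \<noteq> {}"
    and dual_solution: "dual_solution_set f h X K \<theta>star \<noteq> {}"
    and no_gap: "(SUP \<mu>. dual_function f h X K 0 \<mu> \<theta>star) = optimal_value f h X K \<theta>star"
    \<comment> \<open>(i)\<close>
    and h: "\<And>z t. t \<in> \<Theta> \<Longrightarrow> h z t = A t *v z + b t"
    and A_Lip: "\<And>t. t \<in> \<Theta> \<Longrightarrow> spectral_norm (A t - A \<theta>star) \<le> L\<^sub>A * norm (t - \<theta>star)"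
    and b_Lip: "\<And>t. t \<in> \<Theta> \<Longrightarrow> norm (b t - b \<theta>star) \<le> L\<^sub>b * norm (t - \<theta>star)"
    and A_cont: "continuous_on \<Theta> (\<lambda>t. spectral_norm (A t))"
    \<comment> \<open>(ii)\<close>
    and f_convex: "\<And>t. t \<in> \<Theta> \<Longrightarrow> ereal_convex_on X (\<lambda>z. f z t)"
    and f_Lip: "\<And>z t. z \<in> X \<Longrightarrow> t \<in> \<Theta> \<Longrightarrow> \<bar>f z t - f z \<theta>star\<bar> \<le> ereal (L\<^sub>f * norm (t - \<theta>star))"
    \<comment> \<open>(iii)\<close>
    and \<kappa>_cont: "continuous_on (dual_cone K) \<kappa>"
    and \<kappa>_pos: "\<And>\<mu>. \<mu> \<in> dual_cone K \<Longrightarrow> 0 < \<kappa> \<mu>"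
    and argmin_nonempty: "\<And>\<mu> t. \<mu> \<in> dual_cone K \<Longrightarrow> t \<in> \<Theta> \<Longrightarrow> lagrangian_argmin f h X K \<mu> t \<noteq> {}"
    and argmin_Lip: "\<And>\<mu> t. \<mu> \<in> dual_cone K \<Longrightarrow> t \<in> \<Theta> \<Longrightarrow>
        lagrangian_argmin f h X K \<mu> t
          \<subseteq> {z + (\<kappa> \<mu> * norm (t - \<theta>star)) *\<^sub>R u | z u.
                z \<in> lagrangian_argmin f h X K \<mu> \<theta>star \<and> u \<in> cball 0 1}"
    \<comment> \<open>parameter sequence and iterates\<close>
    and \<tau>: "0 < \<tau>" "\<tau> < 1"
    and \<theta>_in: "\<And>k. \<theta> k \<in> \<Theta>"
    and \<theta>_rate: "\<And>k. norm (\<theta> k - \<theta>star) \<le> \<tau> ^ k * norm (\<theta> 0 - \<theta>star)"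
    and \<rho>: "0 < \<rho>"
    and \<alpha>: "\<And>k. 0 \<le> \<alpha> k" "summable (\<lambda>k. sqrt (\<alpha> k))"
    and iterates: "ipalm f h X K (\<lambda>_. \<rho>) \<alpha> \<theta> x lam"
    and lamstar: "lamstar \<in> dual_solution_set f h X K \<theta>star"
    \<comment> \<open>constants\<close>
    and D\<^sub>x: "D\<^sub>x = (SUP z\<in>X. norm z)"
    and Lh\<^sub>\<theta>: "Lh\<^sub>\<theta> = L\<^sub>A * D\<^sub>x + L\<^sub>b"
    and Lh\<^sub>x: "Lh\<^sub>x = (SUP t\<in>\<Theta>. spectral_norm (A t))"
    and \<kappa>\<^sub>d: "\<And>\<mu>. \<kappa>\<^sub>d \<mu> = Lh\<^sub>\<theta> + \<kappa> \<mu> * Lh\<^sub>x"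
    and \<kappa>bar: "\<kappa>bar = (SUP k\<in>{1..}. \<kappa>\<^sub>d (lam k))"
    and C\<^sub>lam: "C\<^sub>lam = sqrt (2 * \<rho>) * (\<Sum>i. sqrt (\<alpha> i))
        + \<rho> * \<kappa>\<^sub>d lamstar * (norm (\<theta> 0 - \<theta>star) / (1 - \<tau>)) + norm (lam 0 - lamstar)"
    and B\<^sub>g: "B\<^sub>g = 1 / (2 * \<rho>) * (norm (lam 0 - lamstar))\<^sup>2
        + C\<^sub>lam * (sqrt (2 / \<rho>) * (\<Sum>k. sqrt (\<alpha> k)) + \<kappa>bar * norm (\<theta> 0 - \<theta>star) / (1 - \<tau>))"
    and C\<^sub>1: "C\<^sub>1 = sqrt (2 * B\<^sub>g / \<rho> + (C\<^sub>lam / \<rho>)\<^sup>2)"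
    and C\<^sub>2: "C\<^sub>2 = sqrt (2 / \<rho>) * (\<Sum>i. sqrt (\<alpha> i))
        + (Lh\<^sub>\<theta> + \<kappa>bar) * norm (\<theta> 0 - \<theta>star) / (1 - \<tau>)"
  shows "\<forall>k\<ge>1. infdist (h ((1 / real k) *\<^sub>R (\<Sum>i=1..k. x i)) \<theta>star) (uminus ` K)
           \<le> C\<^sub>1 / sqrt (real k) + C\<^sub>2 / real k"
proof -
  define F where "F t z = real_of_ereal (f z t)" for t z
  define D where "D = dual_cone K"
  define \<delta> where "\<delta> = norm (\<theta> 0 - \<theta>star)"
  note Dcl = dual_cone_convex_closed[of K, folded D_def]
  have F: "f z t = ereal (F t z)" if "z \<in> X" "t \<in> \<Theta>" for z t
  proof -
    (* \<infinity> - \<infinity> = \<infinity> in ereal, so the Lipschitz bound already at t = \<theta>star forces finiteness. *)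
    have "f z \<theta>star \<noteq> \<infinity>"
      using f_Lip[OF that(1) \<theta>star] by (cases "f z \<theta>star") auto
    then obtain r where r: "f z \<theta>star = ereal r"
      using f_proper[OF \<theta>star] by (cases "f z \<theta>star") auto
    then show ?thesis
      using f_Lip[OF that] f_proper[OF that(2), of z] unfolding F_def by (cases "f z t") auto
  qed
  have Xne: "X \<noteq> {}" using iterates by (auto simp: ipalm_def)
  have F_convex: "convex_on X (F t)" if t: "t \<in> \<Theta>" for t
  proof (rule convex_onI)
    fix u z w assume *: "(0::real) < u" "u < 1" "z \<in> X" "w \<in> X"
    then have "(1 - u) *\<^sub>R z + u *\<^sub>R w \<in> X" using X(1) by (simp add: convex_alt)
    then show "F t ((1 - u) *\<^sub>R z + u *\<^sub>R w) \<le> (1 - u) * F t z + u * F t w"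
      using f_convex[OF t, unfolded ereal_convex_on_def, THEN conjunct2, rule_format, OF *(3,4), of u] * t
      by (simp add: F)
  qed (rule X(1))
  have lag0: "lagrangian f h K 0 z \<mu> t = ereal (F t z + \<mu> \<bullet> h z t)"
    if "\<mu> \<in> D" "z \<in> X" "t \<in> \<Theta>" for \<mu> z t
    using that by (simp add: lagrangian_def F D_def)
  have argmin_iff: "z \<in> lagrangian_argmin f h X K \<mu> t \<longleftrightarrow>
      z \<in> X \<and> (\<forall>w\<in>X. F t z + \<mu> \<bullet> h z t \<le> F t w + \<mu> \<bullet> h w t)"
    if "\<mu> \<in> D" "t \<in> \<Theta>" for \<mu> z t
    using that by (auto simp: lagrangian_argmin_def is_arg_min_def lag0 not_less)
  have dual0: "dual_function f h X K 0 \<mu> t = ereal (F t z + \<mu> \<bullet> h z t)"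
    if "\<mu> \<in> D" "t \<in> \<Theta>" "z \<in> lagrangian_argmin f h X K \<mu> t" for \<mu> z t
    unfolding dual_function_def using that argmin_iff[OF that(1,2)]
    by (intro INF_eqI) (auto simp: lag0)
  have lamstar_max: "dual_function f h X K 0 \<mu> \<theta>star \<le> dual_function f h X K 0 lamstar \<theta>star" for \<mu>
    using lamstar by (auto simp: dual_solution_set_def is_arg_max_def not_less)
  have lamstarD: "lamstar \<in> D"
  proof (rule ccontr)
    assume "lamstar \<notin> D"
    then have "dual_function f h X K 0 lamstar \<theta>star = -\<infinity>"
      using Xne by (simp add: dual_function_def lagrangian_def D_def)
    moreover obtain z where "z \<in> lagrangian_argmin f h X K 0 \<theta>star"
      using argmin_nonempty[OF _ \<theta>star] Dcl(3) by (auto simp: D_def)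
    ultimately show False
      using lamstar_max[of 0] dual0[OF Dcl(3) \<theta>star] by simp
  qed
  have lam0: "lam 0 \<in> D" and xX: "x (Suc k) \<in> X"
    and lam_Suc: "lam (Suc k) = \<rho> *\<^sub>R closest_point D (h (x (Suc k)) (\<theta> k) + lam k /\<^sub>R \<rho>)"
    and x_min: "lagrangian f h K \<rho> (x (Suc k)) (lam k) (\<theta> k)
                  \<le> dual_function f h X K \<rho> (lam k) (\<theta> k) + ereal (\<alpha> k)" for k
    using iterates \<rho> by (auto simp: ipalm_def grad_lagrangian_def D_def algebra_simps)
  have lamD: "lam k \<in> D" for k
  proof (cases k)
    case (Suc j)
    then show ?thesis
      unfolding Suc lam_Suc using \<rho> moreau_decomposition(1)[OF K]
      by (auto simp: D_def intro!: dual_cone_scaleR)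
  qed (use lam0 in simp)

  have Dx: "norm z \<le> D\<^sub>x" if "z \<in> X" for z
    unfolding D\<^sub>x using that compact_continuous_image[OF continuous_on_norm_id X(2)]
    by (intro cSUP_upper) (auto intro: bounded_imp_bdd_above compact_imp_bounded)
  have Dx0: "0 \<le> D\<^sub>x" using Xne Dx norm_ge_zero order_trans by blast
  have Lhx: "spectral_norm (A t) \<le> Lh\<^sub>x" if "t \<in> \<Theta>" for t
    unfolding Lh\<^sub>x using that compact_continuous_image[OF A_cont \<Theta>(2)]
    by (intro cSUP_upper) (auto intro: bounded_imp_bdd_above compact_imp_bounded)
  have Lhx0: "0 \<le> Lh\<^sub>x" using Lhx[OF \<theta>star] spectral_norm_nonneg order_trans by blast
  have h_theta: "norm (h z t - h z \<theta>star) \<le> Lh\<^sub>\<theta> * norm (t - \<theta>star)" if "z \<in> X" "t \<in> \<Theta>" for z t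
  proof -
    have "h z t - h z \<theta>star = (A t - A \<theta>star) *v z + (b t - b \<theta>star)"
      using that h \<theta>star by (simp add: matrix_vector_mult_diff_rdistrib)
    also have "norm \<dots> \<le> spectral_norm (A t - A \<theta>star) * norm z + norm (b t - b \<theta>star)"
      using norm_matrix_vector_le_spectral_norm by (intro norm_triangle_mono) auto
    also have "\<dots> \<le> (L\<^sub>A * norm (t - \<theta>star)) * D\<^sub>x + L\<^sub>b * norm (t - \<theta>star)"
      using A_Lip[OF that(2)] b_Lip[OF that(2)] Dx[OF that(1)] Dx0 spectral_norm_nonneg
      by (intro add_mono mult_mono) (auto intro: order_trans)
    finally show ?thesis by (simp add: Lh\<^sub>\<theta> algebra_simps)
  qed
  have h_x: "norm (h z \<theta>star - h w \<theta>star) \<le> Lh\<^sub>x * norm (z - w)" for z w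
  proof -
    have "h z \<theta>star - h w \<theta>star = A \<theta>star *v (z - w)"
      using h[OF \<theta>star] by (simp add: matrix_vector_mult_diff_distrib)
    then show ?thesis
      using norm_matrix_vector_le_spectral_norm[of "A \<theta>star" "z - w"] mult_right_mono[OF Lhx[OF \<theta>star], of "norm (z - w)"] by simp
  qed

  (* If \<delta> = 0, then \<Theta> may be a single point and the Lipschitz constants may be negative; but then
     they only ever occur multiplied by 0. *)
  have Lh0: "0 \<le> Lh\<^sub>\<theta>" if "\<delta> \<noteq> 0"
  proof -
    have "0 < norm (\<theta> 0 - \<theta>star)" using that by (simp add: \<delta>_def)
    moreover have "0 \<le> L\<^sub>A * norm (\<theta> 0 - \<theta>star)" "0 \<le> L\<^sub>b * norm (\<theta> 0 - \<theta>star)"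
      using A_Lip[OF \<theta>_in, of 0] b_Lip[OF \<theta>_in, of 0] spectral_norm_nonneg norm_ge_zero order_trans by blast+
    ultimately show ?thesis using Dx0 by (simp add: Lh\<^sub>\<theta> zero_le_mult_iff)
  qed
  have \<kappa>d0: "0 \<le> \<kappa>\<^sub>d \<mu>" if "\<delta> \<noteq> 0" "\<mu> \<in> D" for \<mu>
    using Lh0[OF that(1)] \<kappa>_pos[of \<mu>] that(2) Lhx0 by (simp add: \<kappa>\<^sub>d D_def)

  (* The supergradient h z t of the dual function at t, and h w \<theta>star of the one at \<theta>star, for the
     minimizer w near z that (iii) provides. *)
  have pert: "\<exists>z\<in>X. \<exists>s. (\<forall>w\<in>X. F t z + \<mu> \<bullet> h z t \<le> F t w + \<mu> \<bullet> h w t)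
           \<and> norm (h z t - s) \<le> \<kappa>\<^sub>d \<mu> * norm (t - \<theta>star) \<and> (\<mu> - lamstar) \<bullet> s \<le> 0"
    if \<mu>: "\<mu> \<in> D" and t: "t \<in> \<Theta>" for \<mu> t
  proof -
    have \<mu>': "\<mu> \<in> dual_cone K" using \<mu> by (simp add: D_def)
    obtain z where z: "z \<in> lagrangian_argmin f h X K \<mu> t"
      using argmin_nonempty[OF \<mu>' t] by blast
    then obtain w u where w: "w \<in> lagrangian_argmin f h X K \<mu> \<theta>star"
      and u: "norm u \<le> 1" and zw: "z = w + (\<kappa> \<mu> * norm (t - \<theta>star)) *\<^sub>R u"
      using argmin_Lip[OF \<mu>' t] by auto
    have zX: "z \<in> X" and wX: "w \<in> X"
      using z w argmin_iff[OF \<mu> t] argmin_iff[OF \<mu> \<theta>star] by auto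
    have "norm (z - w) \<le> \<kappa> \<mu> * norm (t - \<theta>star)"
      using u \<kappa>_pos[OF \<mu>'] by (simp add: zw mult_left_le)
    then have "Lh\<^sub>x * norm (z - w) \<le> Lh\<^sub>x * (\<kappa> \<mu> * norm (t - \<theta>star))"
      using Lhx0 by (rule mult_left_mono)
    then have "norm (h z t - h w \<theta>star) \<le> \<kappa>\<^sub>d \<mu> * norm (t - \<theta>star)"
      using norm_triangle_le[OF add_mono[OF h_theta[OF zX t] h_x[of z w]]]
      by (simp add: \<kappa>\<^sub>d algebra_simps)
    moreover have "(\<mu> - lamstar) \<bullet> h w \<theta>star \<le> 0"
    proof -
      have "ereal (F \<theta>star w + \<mu> \<bullet> h w \<theta>star) \<le> dual_function f h X K 0 lamstar \<theta>star"
        using lamstar_max[of \<mu>] dual0[OF \<mu> \<theta>star w] by simp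
      also have "\<dots> \<le> lagrangian f h K 0 w lamstar \<theta>star"
        unfolding dual_function_def using wX by (rule INF_lower)
      finally show ?thesis by (simp add: lag0[OF lamstarD wX \<theta>star] inner_simps)
    qed
    ultimately show ?thesis using zX z argmin_iff[OF \<mu> t] by blast
  qed

  (* p is the exact proximal step from lam k at the parameter \<theta> k. *)
  have step: "\<exists>p. norm (lam (Suc k) - p) \<le> sqrt (2 * \<rho>) * sqrt (\<alpha> k)
      \<and> norm (p - lamstar) \<le> norm (lam k - lamstar) + \<rho> * (\<kappa>\<^sub>d lamstar * (\<tau> ^ k * \<delta>))
      \<and> norm (p - lam k) \<le> norm (lam k - lamstar) + \<rho> * (\<kappa>\<^sub>d lamstar * (\<tau> ^ k * \<delta>))" for k
  proof -
    define t where "t = \<theta> k"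
    have t: "t \<in> \<Theta>" by (simp add: t_def \<theta>_in)
    define H where "H z = h z t" for z
    obtain z0 where z0: "z0 \<in> lagrangian_argmin f h X K 0 t"
      using argmin_nonempty[OF _ t] Dcl(3) by (auto simp: D_def)
    have lower: "F t z0 \<le> F t z" if "z \<in> X" for z
      using z0 argmin_iff[OF Dcl(3) t] that by auto
    have H_cont: "continuous_on X H"
      unfolding H_def h[OF t] by (intro continuous_intros matrix_vector_mult_linear_continuous_on)
    have H_aff: "H ((1 - s) *\<^sub>R z + s *\<^sub>R w) = (1 - s) *\<^sub>R H z + s *\<^sub>R H w" for s z w
      unfolding H_def h[OF t]
      by (simp add: matrix_vector_right_distrib matrix_vector_mult_scaleR algebra_simps)
    obtain q where q: "q \<in> D"
      and prox: "\<And>\<mu> c z. \<mu> \<in> D \<Longrightarrow> (\<And>w. w \<in> X \<Longrightarrow> c \<le> F t w + \<mu> \<bullet> H w) \<Longrightarrow> z \<in> X \<Longrightarrow>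
           c \<le> F t z + (\<rho> *\<^sub>R q) \<bullet> H z + (\<mu> - \<rho> *\<^sub>R q) \<bullet> (q - lam k /\<^sub>R \<rho>)"
      and inexact: "\<And>z a. z \<in> X \<Longrightarrow>
           (\<And>w. w \<in> X \<Longrightarrow> F t z + \<rho> / 2 * (infdist (H z + lam k /\<^sub>R \<rho>) (uminus ` K))\<^sup>2
                 \<le> F t w + \<rho> / 2 * (infdist (H w + lam k /\<^sub>R \<rho>) (uminus ` K))\<^sup>2 + a) \<Longrightarrow>
           \<rho> / 2 * (norm (closest_point D (H z + lam k /\<^sub>R \<rho>) - q))\<^sup>2 \<le> a"
      using inexact_prox_point[OF K X(2) Xne F_convex[OF t] lower H_cont H_aff \<rho>,
          of "lam k /\<^sub>R \<rho>", folded D_def] by blast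
    define p where "p = \<rho> *\<^sub>R q"
    have pD: "p \<in> D" using q \<rho> by (auto simp: p_def D_def intro: dual_cone_scaleR)
    have q_eq: "q - lam k /\<^sub>R \<rho> = (p - lam k) /\<^sub>R \<rho>"
      using \<rho> by (simp add: p_def algebra_simps)
    have e_cont: "continuous_on D (\<lambda>\<mu>. \<kappa>\<^sub>d \<mu> * norm (t - \<theta>star))"
      unfolding \<kappa>\<^sub>d D_def by (intro continuous_intros \<kappa>_cont)
    have rate: "norm (t - \<theta>star) \<le> \<tau> ^ k * \<delta>" using \<theta>_rate by (simp add: t_def \<delta>_def)
    have e_le: "0 \<le> \<kappa>\<^sub>d lamstar * norm (t - \<theta>star) \<and>
        \<kappa>\<^sub>d lamstar * norm (t - \<theta>star) \<le> \<kappa>\<^sub>d lamstar * (\<tau> ^ k * \<delta>)"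
    proof (cases "\<delta> = 0")
      case False
      then show ?thesis using \<kappa>d0[OF False lamstarD] rate by (auto intro: mult_left_mono)
    qed (use rate in simp)
    have e_rho: "\<rho> * (\<kappa>\<^sub>d lamstar * norm (t - \<theta>star)) \<le> \<rho> * (\<kappa>\<^sub>d lamstar * (\<tau> ^ k * \<delta>))"
      using e_le \<rho> by (intro mult_left_mono[of "\<kappa>\<^sub>d lamstar * norm (t - \<theta>star)"]) auto
    have near: "norm (p - lamstar) \<le> norm (lam k - lamstar) + \<rho> * (\<kappa>\<^sub>d lamstar * norm (t - \<theta>star))"
        "norm (p - lam k) \<le> norm (lam k - lamstar) + \<rho> * (\<kappa>\<^sub>d lamstar * norm (t - \<theta>star))"
    proof -
      have "c \<le> F t z + p \<bullet> H z + (\<mu> - p) \<bullet> ((p - lam k) /\<^sub>R \<rho>)"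
        if "\<mu> \<in> D" "\<And>w. w \<in> X \<Longrightarrow> c \<le> F t w + \<mu> \<bullet> H w" "z \<in> X" for \<mu> c z
        using prox[OF that] unfolding q_eq p_def[symmetric] .
      note bounds = exact_dual_step_bounds[where X = X and F = "F t" and H = H,
          OF Dcl(1) lamstarD pD \<rho> this pert[OF _ t, folded H_def] e_cont conjunct1[OF e_le]]
      show "norm (p - lamstar) \<le> norm (lam k - lamstar) + \<rho> * (\<kappa>\<^sub>d lamstar * norm (t - \<theta>star))"
        "norm (p - lam k) \<le> norm (lam k - lamstar) + \<rho> * (\<kappa>\<^sub>d lamstar * norm (t - \<theta>star))"
        by (rule bounds; assumption)+
    qed
    have "\<rho> / 2 * (norm (closest_point D (H (x (Suc k)) + lam k /\<^sub>R \<rho>) - q))\<^sup>2 \<le> \<alpha> k"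
    proof (rule inexact[OF xX])
      fix w assume w: "w \<in> X"
      have "lagrangian f h K \<rho> (x (Suc k)) (lam k) t \<le> lagrangian f h K \<rho> w (lam k) t + ereal (\<alpha> k)"
        using x_min[of k] INF_lower[OF w, of "\<lambda>z. lagrangian f h K \<rho> z (lam k) t"]
        by (auto simp: dual_function_def t_def intro: order_trans add_right_mono)
      then show "F t (x (Suc k)) + \<rho> / 2 * (infdist (H (x (Suc k)) + lam k /\<^sub>R \<rho>) (uminus ` K))\<^sup>2
                 \<le> F t w + \<rho> / 2 * (infdist (H w + lam k /\<^sub>R \<rho>) (uminus ` K))\<^sup>2 + \<alpha> k"
        using \<rho> by (simp add: lagrangian_def F[OF w t] F[OF xX t] H_def)
    qed
    from mult_left_mono[OF this, of "2 * \<rho>"] \<rho>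
    have "(\<rho> * norm (closest_point D (H (x (Suc k)) + lam k /\<^sub>R \<rho>) - q))\<^sup>2 \<le> 2 * \<rho> * \<alpha> k"
      by (simp add: power2_eq_square mult_ac)
    moreover have "lam (Suc k) - p = \<rho> *\<^sub>R (closest_point D (H (x (Suc k)) + lam k /\<^sub>R \<rho>) - q)"
      unfolding lam_Suc by (simp add: p_def H_def t_def scaleR_diff_right)
    ultimately have "(norm (lam (Suc k) - p))\<^sup>2 \<le> 2 * \<rho> * \<alpha> k"
      using \<rho> by simp
    then have "norm (lam (Suc k) - p) \<le> sqrt (2 * \<rho>) * sqrt (\<alpha> k)"
      unfolding real_sqrt_mult[of "2 * \<rho>", symmetric] by (rule real_le_rsqrt)
    then show ?thesis using near e_rho by (intro exI[of _ p]) auto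
  qed

  define S where "S = (\<Sum>i. sqrt (\<alpha> i))"
  define T where "T = \<delta> / (1 - \<tau>)"
  have sum_alpha: "(\<Sum>i<k. sqrt (\<alpha> i)) \<le> S" for k
    unfolding S_def using \<alpha> by (intro sum_le_suminf) auto
  have S0: "0 \<le> S" using sum_alpha[of 0] by simp
  have sum_tau: "(\<Sum>i<k. \<tau> ^ i * \<delta>) \<le> T" for k
  proof -
    have "(\<Sum>i<k. \<tau> ^ i) \<le> (\<Sum>i. \<tau> ^ i)"
      using \<tau> by (intro sum_le_suminf summable_geometric) auto
    also have "\<dots> = 1 / (1 - \<tau>)" using \<tau> by (intro suminf_geometric) auto
    finally have "(\<Sum>i<k. \<tau> ^ i) * \<delta> \<le> 1 / (1 - \<tau>) * \<delta>"
      by (rule mult_right_mono) (simp add: \<delta>_def)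
    then show ?thesis by (simp add: T_def sum_distrib_right)
  qed
  have T0: "0 \<le> T" using \<tau> by (simp add: T_def \<delta>_def)
  have \<delta>T: "\<delta> = 0 \<Longrightarrow> T = 0" by (simp add: T_def)
  have \<kappa>dT: "\<kappa>\<^sub>d lamstar * (\<Sum>i<k. \<tau> ^ i * \<delta>) \<le> \<kappa>\<^sub>d lamstar * T" for k
  proof (cases "\<delta> = 0")
    case False
    then show ?thesis using \<kappa>d0[OF False lamstarD] sum_tau by (intro mult_left_mono)
  qed (simp add: \<delta>T)
  have Clam: "C\<^sub>lam = sqrt (2 * \<rho>) * S + \<rho> * (\<kappa>\<^sub>d lamstar * T) + norm (lam 0 - lamstar)"
    by (simp add: C\<^sub>lam S_def T_def \<delta>_def)
  have partial: "norm (lam k - lamstar) \<le> norm (lam 0 - lamstar)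
      + sqrt (2 * \<rho>) * (\<Sum>i<k. sqrt (\<alpha> i)) + \<rho> * (\<kappa>\<^sub>d lamstar * (\<Sum>i<k. \<tau> ^ i * \<delta>))" for k
  proof (induction k)
    case (Suc k)
    obtain p where p: "norm (lam (Suc k) - p) \<le> sqrt (2 * \<rho>) * sqrt (\<alpha> k)"
      "norm (p - lamstar) \<le> norm (lam k - lamstar) + \<rho> * (\<kappa>\<^sub>d lamstar * (\<tau> ^ k * \<delta>))"
      using step[of k] by blast
    have "norm (lam (Suc k) - lamstar) \<le> norm (lam (Suc k) - p) + norm (p - lamstar)"
      using norm_triangle_ineq[of "lam (Suc k) - p" "p - lamstar"] by simp
    then show ?case using p Suc.IH by (simp add: algebra_simps)
  qed simp
  have sums_le: "sqrt (2 * \<rho>) * (\<Sum>i<k. sqrt (\<alpha> i)) \<le> sqrt (2 * \<rho>) * S"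
      "\<rho> * (\<kappa>\<^sub>d lamstar * (\<Sum>i<k. \<tau> ^ i * \<delta>)) \<le> \<rho> * (\<kappa>\<^sub>d lamstar * T)" for k
    using sum_alpha \<kappa>dT \<rho> by (auto intro!: mult_left_mono)
  have lam_bound: "norm (lam k - lamstar) \<le> C\<^sub>lam" for k
    using partial[of k] sums_le[of k] by (simp add: Clam)
  have lam1: "norm (lam 1 - lam 0) \<le> C\<^sub>lam"
  proof -
    obtain p where p: "norm (lam (Suc 0) - p) \<le> sqrt (2 * \<rho>) * sqrt (\<alpha> 0)"
      "norm (p - lam 0) \<le> norm (lam 0 - lamstar) + \<rho> * (\<kappa>\<^sub>d lamstar * (\<tau> ^ 0 * \<delta>))"
      using step[of 0] by blast
    have "norm (lam 1 - lam 0) \<le> norm (lam (Suc 0) - p) + norm (p - lam 0)"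
      using norm_triangle_ineq[of "lam 1 - p" "p - lam 0"] by simp
    then show ?thesis using p sums_le[of 1] by (simp add: Clam)
  qed
  have Clam0: "0 \<le> C\<^sub>lam" using lam_bound[of 0] norm_ge_zero order_trans by blast

  (* The supremum defining \<kappa>bar is that of a bounded set because the multipliers stay in a compact
     set; otherwise its value would be arbitrary. *)
  have \<kappa>bar0: "0 \<le> \<kappa>bar" if "\<delta> \<noteq> 0"
  proof -
    have "compact (D \<inter> cball lamstar C\<^sub>lam)" using Dcl(2) by (intro closed_Int_compact) auto
    moreover have "continuous_on (D \<inter> cball lamstar C\<^sub>lam) \<kappa>\<^sub>d"
      unfolding \<kappa>\<^sub>d[abs_def] using \<kappa>_cont
      by (intro continuous_intros) (auto simp: D_def intro: continuous_on_subset)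
    ultimately have "bdd_above (\<kappa>\<^sub>d ` (D \<inter> cball lamstar C\<^sub>lam))"
      by (intro bounded_imp_bdd_above compact_imp_bounded compact_continuous_image)
    then have "bdd_above ((\<lambda>k. \<kappa>\<^sub>d (lam k)) ` {1..})"
      by (rule bdd_above_mono) (use lamD lam_bound in \<open>auto simp: dist_norm norm_minus_commute\<close>)
    then have "\<kappa>\<^sub>d (lam 1) \<le> \<kappa>bar" unfolding \<kappa>bar by (intro cSUP_upper) auto
    then show ?thesis using \<kappa>d0[OF that lamD[of 1]] by simp
  qed
  define c where "c = sqrt (2 / \<rho>) * S + \<kappa>bar * T"
  have "0 \<le> \<kappa>bar * T" using \<kappa>bar0 T0 \<delta>T by (cases "\<delta> = 0") auto
  then have c0: "0 \<le> c" using S0 \<rho> by (simp add: c_def)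
  define a where "a = C\<^sub>lam / \<rho>"
  define e where "e = norm (lam 0 - lamstar) / \<rho>"
  have C1: "C\<^sub>1 = sqrt (a\<^sup>2 + e\<^sup>2 + 2 * a * c)"
  proof -
    have "B\<^sub>g = 1 / (2 * \<rho>) * (norm (lam 0 - lamstar))\<^sup>2 + C\<^sub>lam * c"
      by (simp add: B\<^sub>g c_def S_def T_def \<delta>_def)
    then have "2 * B\<^sub>g / \<rho> + (C\<^sub>lam / \<rho>)\<^sup>2 = a\<^sup>2 + e\<^sup>2 + 2 * a * c"
      using \<rho> by (simp add: a_def e_def field_simps power2_eq_square)
    then show ?thesis by (simp add: C\<^sub>1)
  qed
  have C2: "C\<^sub>2 = c + Lh\<^sub>\<theta> * T"
    by (simp add: C\<^sub>2 c_def S_def T_def \<delta>_def add_divide_distrib algebra_simps)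

  show ?thesis
  proof (intro allI impI)
    fix k :: nat assume k: "1 \<le> k"
    define N where "N = uminus ` K"
    note Ncone = convex_cone_uminus_image[OF K(2), folded N_def]
    (* Each multiplier update is a projection whose residual lies in -K; summed up, the multiplier
       differences telescope. *)
    define y where "y i = h (x (Suc i)) (\<theta> i) + (lam i - lam (Suc i)) /\<^sub>R \<rho>" for i
    have y: "y i \<in> N" for i
    proof -
      have "y i = (h (x (Suc i)) (\<theta> i) + lam i /\<^sub>R \<rho>)
            - closest_point D (h (x (Suc i)) (\<theta> i) + lam i /\<^sub>R \<rho>)"
        using \<rho> by (simp add: y_def lam_Suc algebra_simps)
      then show ?thesis using moreau_decomposition(2)[OF K] by (simp add: N_def D_def)
    qed
    have sumN: "(\<Sum>i<n. y i) \<in> N" for n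
      by (induction n) (auto intro: convex_cone_add[OF Ncone] y convex_cone_contains_0[OF Ncone])
    have avgN: "(1 / real k) *\<^sub>R (\<Sum>i<k. y i) \<in> N"
      using sumN by (intro convex_cone_scaleR[OF Ncone]) auto
    have h_avg: "h ((1 / real k) *\<^sub>R (\<Sum>i=1..k. x i)) \<theta>star
        = (1 / real k) *\<^sub>R (\<Sum>i<k. h (x (Suc i)) \<theta>star)"
    proof -
      have "(\<Sum>i=1..k. x i) = (\<Sum>i<k. x (Suc i))"
        by (simp add: sum.atLeast1_atMost_eq)
      moreover have "(1 / real k) *\<^sub>R (\<Sum>i<k. b \<theta>star) = b \<theta>star"
        using k unfolding sum_constant_scaleR by simp
      ultimately show ?thesis
        unfolding h[OF \<theta>star]
        by (simp add: sum.distrib matrix_vector_mult_scaleR scaleR_add_right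
            linear_sum[OF matrix_vector_mul_linear] )
    qed
    have tele: "(\<Sum>i<n. (lam i - lam (Suc i)) /\<^sub>R \<rho>) = (lam 0 - lam n) /\<^sub>R \<rho>" for n
      by (induction n) (auto simp: algebra_simps)
    have "h ((1 / real k) *\<^sub>R (\<Sum>i=1..k. x i)) \<theta>star - (1 / real k) *\<^sub>R (\<Sum>i<k. y i)
      = (1 / real k) *\<^sub>R ((\<Sum>i<k. h (x (Suc i)) \<theta>star - h (x (Suc i)) (\<theta> i)) + (lam k - lam 0) /\<^sub>R \<rho>)"
      unfolding h_avg y_def sum.distrib tele sum_subtractf by (simp add: algebra_simps)
    also have "norm \<dots> \<le> (1 / real k) * (Lh\<^sub>\<theta> * T + norm (lam k - lam 0) / \<rho>)"
    proof -
      have "norm (\<Sum>i<k. h (x (Suc i)) \<theta>star - h (x (Suc i)) (\<theta> i))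
          \<le> (\<Sum>i<k. Lh\<^sub>\<theta> * norm (\<theta> i - \<theta>star))"
        using h_theta[OF xX \<theta>_in] by (intro sum_norm_le) (simp add: norm_minus_commute)
      also have "\<dots> \<le> Lh\<^sub>\<theta> * T"
      proof (cases "\<delta> = 0")
        case True
        then show ?thesis using \<theta>_rate \<delta>T by (simp add: \<delta>_def)
      next
        case False
        have "(\<Sum>i<k. norm (\<theta> i - \<theta>star)) \<le> T"
          by (rule order_trans[OF sum_mono sum_tau[of k]]) (simp add: \<delta>_def \<theta>_rate)
        then show ?thesis
          using Lh0[OF False] by (simp add: sum_distrib_left[symmetric] mult_left_mono)
      qed
      finally have "norm ((\<Sum>i<k. h (x (Suc i)) \<theta>star - h (x (Suc i)) (\<theta> i)) + (lam k - lam 0) /\<^sub>R \<rho>)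
          \<le> Lh\<^sub>\<theta> * T + norm (lam k - lam 0) / \<rho>"
        using \<rho> by (intro norm_triangle_mono) (simp_all add: divide_inverse_commute)
      then show ?thesis by (simp add: divide_right_mono)
    qed
    finally have "infdist (h ((1 / real k) *\<^sub>R (\<Sum>i=1..k. x i)) \<theta>star) N
        \<le> (1 / real k) * (Lh\<^sub>\<theta> * T + norm (lam k - lam 0) / \<rho>)"
      by (intro infdist_le2[OF avgN]) (simp only: dist_norm)
    also have "\<dots> = (norm (lam k - lam 0) / \<rho>) / real k + Lh\<^sub>\<theta> * T / real k"
      by (simp add: add_divide_distrib)
    also have "(norm (lam k - lam 0) / \<rho>) / real k \<le> C\<^sub>1 / sqrt (real k)"
      unfolding C1
    proof (rule violation_rate_arith)
      have "norm (lam k - lam 0) \<le> norm (lam k - lamstar) + norm (lam 0 - lamstar)"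
        using norm_triangle_ineq4[of "lam k - lamstar" "lam 0 - lamstar"] by simp
      then show "norm (lam k - lam 0) / \<rho> \<le> a + e"
        using lam_bound[of k] \<rho> by (simp add: a_def e_def add_divide_distrib[symmetric] divide_right_mono)
      show "norm (lam k - lam 0) / \<rho> \<le> a" if "k = 1"
        using lam1 \<rho> that by (simp add: a_def divide_right_mono)
    qed (use Clam0 c0 \<rho> k in \<open>auto simp: a_def e_def\<close>)
    finally show "infdist (h ((1 / real k) *\<^sub>R (\<Sum>i=1..k. x i)) \<theta>star) (uminus ` K)
           \<le> C\<^sub>1 / sqrt (real k) + C\<^sub>2 / real k"
      using divide_right_mono[OF c0, of "real k"] by (simp add: C2 N_def add_divide_distrib)
  qed
qed

end
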